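(* Let $(\gamma_s,f_1,f_2):I\to AdS^3\times\Delta_1$ be a pseudo-spherical spacelike framed immersion with curvature $(\alpha,\hat\ell,0,\hat n)$, with $\alpha^2+\hat\epsilon\hat n^2\neq0$ and $g\ne0$ on $I$. Put $$\zeta=\frac{\hat n\gamma_s-\alpha f_2}{\sqrt{\epsilon_\zeta(-\hat n^2-\hat\epsilon\alpha^2)}},\qquad \epsilon_\zeta=\langle\zeta,\zeta\rangle=\mathrm{sgn}(-\hat n^2-\hat\epsilon\alpha^2).$$ Case 1: let $\epsilon_\zeta\hat\epsilon=1$ (then $\zeta$ and $f_1$ are both timelike), and define the focal surface of $\gamma_s$ by $\mathcal{F}_1(s,\theta)=\cos\theta\,\zeta(s)+\sin\theta\,f_1(s)\in AdS^3$. Then the set of singular points of $\mathcal{F}_1$ coincides with the AdS-evolute $\mathcal{E}_a(\gamma_s)$. Case 2: let $\epsilon_\zeta\hat\epsilon=-1$, and define the focal surface of $\gamma_s$ by $\mathcal{F}_2(s,\theta)=P(\theta)\zeta(s)+R(\theta)f_1(s)$, where $(P(\theta),R(\theta))\in\{(\cosh\theta,\sinh\theta),(\sinh\theta,\cosh\theta)\}$. Then the set of singular points of $\mathcal{F}_2$ coincides with the evolute $\mathcal{E}(\gamma_s)$ of $\gamma_s$.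
   Context: $\mathbb{R}^4_2$ is $\mathbb{R}^4$ with $\langle u,w\rangle=-u_1w_1-u_2w_2+u_3w_3+u_4w_4$; the triple product $u\times v\times w$ is the unique vector with $\langle x,u\times v\times w\rangle=\det(x,u,v,w)$ for all $x$. $AdS^3=\{u:\langle u,u\rangle=-1\}$, $S^3_2=\{u:\langle u,u\rangle=1\}$, and $\Delta_1=\{(u,w):\langle u,w\rangle=0\}\subset AdS^3\times S^3_2$ (or $\subset S^3_2\times AdS^3$). A vector $u$ is timelike if $\langle u,u\rangle<0$. A pseudo-spherical spacelike framed immersion $(\gamma_s,f_1,f_2):I\to AdS^3\times\Delta_1$ is a smooth immersion with $\langle\gamma_s,f_i\rangle=\langle\gamma_s',f_i\rangle=0$, $i=1,2$. Here it has curvature $(\alpha,\hat\ell,0,\hat n)$, meaning that with $\mu=\gamma_s\times f_1\times f_2$ and $\hat\epsilon=\langle f_1,f_1\rangle\in\{\pm1\}$ (so $\langle f_2,f_2\rangle=-\hat\epsilon$), $$\gamma_s'=\alpha\mu,\quad f_1'=\hat\ell f_2,\quad f_2'=\hat\ell f_1+\hat n\mu,\quad \mu'=\alpha\gamma_s+\hat\epsilon\hat n f_2 .$$ Put $g=\hat\epsilon(\alpha\hat n'-\hat n\alpha')^2-\hat\ell^2\hat n^2(\hat n^2+\hat\epsilon\alpha^2)$. The (total) evolute is $$\mathcal{E}(\gamma_s)=\pm\frac{\hat\ell\hat n(\hat n\gamma_s-\alpha f_2)-(\alpha\hat n'-\hat n\alpha')f_1}{\sqrt{|g|}} ,$$ which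 lies in $S^3_2$ where $g>0$ and in $AdS^3$ where $g<0$; in the latter case it is denoted $\mathcal{E}_a(\gamma_s)$ and called the AdS-evolute. A focal surface $\mathcal{F}$ has a singularity at $(s_0,\theta_0)$ if and only if $\mathcal{F}\times\frac{\partial\mathcal{F}}{\partial s}\times\frac{\partial\mathcal{F}}{\partial\theta}=0$ at $(s_0,\theta_0)$; the set of singular points is understood as the set of the corresponding points $\mathcal{F}(s_0,\theta_0)$ on the surface (the singular values).
   Formalization: In Case 2 the evolute is taken with one sign, constant on I (both signs in Case 1); it equals the singular points of the two surfaces F_2 together, and each choice of (P,R) gives the part of the evolute in its pseudosphere, since for each choice separately, or with both signs, the claim fails. *)

theory Defs
  imports "HOL-Analysis.Analysis"
begin

section \<open>The semi-Euclidean space of signature (2,2)\<close>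

definition pip :: "real^4 \<Rightarrow> real^4 \<Rightarrow> real" where
  "pip u w = - (u $ 1 * w $ 1) - u $ 2 * w $ 2 + u $ 3 * w $ 3 + u $ 4 * w $ 4"

definition timelike :: "real^4 \<Rightarrow> bool" where
  "timelike u \<longleftrightarrow> pip u u < 0"

definition AdS3 :: "(real^4) set" where
  "AdS3 = {u. pip u u = -1}"

definition S32 :: "(real^4) set" where
  "S32 = {u. pip u u = 1}"

definition Delta1_AdS_S :: "((real^4) \<times> (real^4)) set" where
  "Delta1_AdS_S = {(u, w). u \<in> AdS3 \<and> w \<in> S32 \<and> pip u w = 0}"

definition Delta1_S_AdS :: "((real^4) \<times> (real^4)) set" where
  "Delta1_S_AdS = {(u, w). u \<in> S32 \<and> w \<in> AdS3 \<and> pip u w = 0}"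

definition triple_prod :: "real^4 \<Rightarrow> real^4 \<Rightarrow> real^4 \<Rightarrow> real^4" where
  "triple_prod u v w = (THE y. \<forall>x. pip x y = det (vector [x, u, v, w] :: real^4^4))"

lemma vector_4_nth:
  "(vector [a, b, c, d] :: 'a::zero^4) $ 1 = a"
  "(vector [a, b, c, d] :: 'a::zero^4) $ 2 = b"
  "(vector [a, b, c, d] :: 'a::zero^4) $ 3 = c"
  "(vector [a, b, c, d] :: 'a::zero^4) $ 4 = d"
  by (simp_all add: vector_def)

lemma linear_det_first_row:
  "linear (\<lambda>x. det (vector [x, u, v, w] :: real^4^4))"
proof -
  define c :: "4 \<Rightarrow> real^4" where "c = (\<lambda>i. (vector [0, u, v, w] :: real^4^4) $ i)"
  have eq: "(vector [x, u, v, w] :: real^4^4) = (\<chi> i. if i = 1 then x else c i)" for x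
    by (simp add: vec_eq_iff forall_4 c_def vector_4_nth)
  show ?thesis
    unfolding eq
  proof (rule linearI)
    show "det (\<chi> i. if i = 1 then x + y else c i)
        = det (\<chi> i. if i = 1 then x else c i) + det (\<chi> i. if i = 1 then y else c i)" for x y
      by (rule det_row_add)
    show "det (\<chi> i. if i = 1 then r *\<^sub>R x else c i)
        = r *\<^sub>R det (\<chi> i. if i = 1 then x else c i)" for r x
      using det_row_mul[of 1 r "\<lambda>_. x" c] by (simp only: scalar_mult_eq_scaleR real_scaleR_def)
  qed
qed

lemma ex1_triple_prod:
  "\<exists>!y. \<forall>x. pip x y = det (vector [x, u, v, w] :: real^4^4)"
proof -
  define D where "D = (\<lambda>x. det (vector [x, u, v, w] :: real^4^4))"
  have lin: "linear D"
    unfolding D_def by (rule linear_det_first_row)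
  have D: "D x = x $ 1 * D (axis 1 1) + x $ 2 * D (axis 2 1) + x $ 3 * D (axis 3 1) + x $ 4 * D (axis 4 1)" for x
  proof -
    have "D x = D (\<Sum>i\<in>UNIV. x $ i *\<^sub>R axis i 1)"
      using basis_expansion[of x] by (simp only: scalar_mult_eq_scaleR)
    also have "\<dots> = (\<Sum>i\<in>UNIV. x $ i * D (axis i 1))"
      using lin by (simp add: linear_sum linear_scale)
    finally show ?thesis
      by (simp add: sum_4)
  qed
  let ?y = "vector [- D (axis 1 1), - D (axis 2 1), D (axis 3 1), D (axis 4 1)] :: real^4"
  have "pip x ?y = D x" for x
    unfolding D[of x] by (simp add: pip_def vector_4_nth)
  moreover have "y = ?y" if "\<forall>x. pip x y = D x" for y
    using that[rule_format, of "axis 1 1"] that[rule_format, of "axis 2 1"]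
      that[rule_format, of "axis 3 1"] that[rule_format, of "axis 4 1"]
    by (simp add: vec_eq_iff forall_4 vector_4_nth pip_def axis_def)
  ultimately show ?thesis
    unfolding D_def by blast
qed

lemma pip_triple_prod:
  "pip x (triple_prod u v w) = det (vector [x, u, v, w] :: real^4^4)"
  using theI'[OF ex1_triple_prod, of u v w] unfolding triple_prod_def by blast


section \<open>Framed immersions\<close>

text \<open>Derivatives on the interval \<open>I\<close> are taken within \<open>I\<close>, hence are one-sided at
  endpoints that belong to \<open>I\<close>.\<close>

definition smooth_on :: "real set \<Rightarrow> (real \<Rightarrow> 'a::real_normed_vector) \<Rightarrow> bool" where
  "smooth_on I f \<longleftrightarrow>
     (\<exists>D. (\<forall>s\<in>I. D 0 s = f s) \<and>
          (\<forall>k::nat. \<forall>s\<in>I. (D k has_vector_derivative D (Suc k) s) (at s within I)))"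

definition spacelike_framed_immersion ::
  "real set \<Rightarrow> (real \<Rightarrow> real^4) \<Rightarrow> (real \<Rightarrow> real^4) \<Rightarrow> (real \<Rightarrow> real^4) \<Rightarrow> bool" where
  "spacelike_framed_immersion I \<gamma> f1 f2 \<longleftrightarrow>
     (\<forall>s\<in>I. \<gamma> s \<in> AdS3) \<and>
     ((\<forall>s\<in>I. (f1 s, f2 s) \<in> Delta1_AdS_S) \<or> (\<forall>s\<in>I. (f1 s, f2 s) \<in> Delta1_S_AdS)) \<and>
     smooth_on I (\<lambda>s. (\<gamma> s, f1 s, f2 s)) \<and>
     (\<forall>s\<in>I. vector_derivative (\<lambda>s. (\<gamma> s, f1 s, f2 s)) (at s within I) \<noteq> 0) \<and>
     (\<forall>s\<in>I. pip (\<gamma> s) (f1 s) = 0 \<and> pip (\<gamma> s) (f2 s) = 0 \<and>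
        pip (vector_derivative \<gamma> (at s within I)) (f1 s) = 0 \<and>
        pip (vector_derivative \<gamma> (at s within I)) (f2 s) = 0)"

definition frame_mu ::
  "(real \<Rightarrow> real^4) \<Rightarrow> (real \<Rightarrow> real^4) \<Rightarrow> (real \<Rightarrow> real^4) \<Rightarrow> real \<Rightarrow> real^4" where
  "frame_mu \<gamma> f1 f2 s = triple_prod (\<gamma> s) (f1 s) (f2 s)"

text \<open>Curvature \<open>(\<alpha>, l, 0, n)\<close>, where \<open>e\<close> is the constant value of \<open>pip (f1 s) (f1 s)\<close>.\<close>

definition has_curvature ::
  "real set \<Rightarrow> (real \<Rightarrow> real^4) \<Rightarrow> (real \<Rightarrow> real^4) \<Rightarrow> (real \<Rightarrow> real^4) \<Rightarrow> real
     \<Rightarrow> (real \<Rightarrow> real) \<Rightarrow> (real \<Rightarrow> real) \<Rightarrow> (real \<Rightarrow> real) \<Rightarrow> bool" where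
  "has_curvature I \<gamma> f1 f2 e \<alpha> l n \<longleftrightarrow>
     (\<forall>s\<in>I. pip (f1 s) (f1 s) = e \<and>
        (\<gamma> has_vector_derivative \<alpha> s *\<^sub>R frame_mu \<gamma> f1 f2 s) (at s within I) \<and>
        (f1 has_vector_derivative l s *\<^sub>R f2 s) (at s within I) \<and>
        (f2 has_vector_derivative l s *\<^sub>R f1 s + n s *\<^sub>R frame_mu \<gamma> f1 f2 s) (at s within I) \<and>
        (frame_mu \<gamma> f1 f2 has_vector_derivative
           \<alpha> s *\<^sub>R \<gamma> s + (e * n s) *\<^sub>R f2 s) (at s within I))"


section \<open>Evolutes\<close>

definition wronsk :: "real set \<Rightarrow> (real \<Rightarrow> real) \<Rightarrow> (real \<Rightarrow> real) \<Rightarrow> real \<Rightarrow> real" where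
  "wronsk I \<alpha> n s =
     \<alpha> s * vector_derivative n (at s within I) - n s * vector_derivative \<alpha> (at s within I)"

definition g_fun ::
  "real set \<Rightarrow> real \<Rightarrow> (real \<Rightarrow> real) \<Rightarrow> (real \<Rightarrow> real) \<Rightarrow> (real \<Rightarrow> real) \<Rightarrow> real \<Rightarrow> real" where
  "g_fun I e \<alpha> l n s =
     e * (wronsk I \<alpha> n s)\<^sup>2 - (l s)\<^sup>2 * (n s)\<^sup>2 * ((n s)\<^sup>2 + e * (\<alpha> s)\<^sup>2)"

text \<open>The argument \<open>\<sigma> \<in> {1, -1}\<close> is the sign \<open>\<plusminus>\<close> in the formula for the evolute.  The compact
  focal surface (cos, sin) contains both signs as singular values.  On the hyperbolic ones the
  function cosh is positive, so only one of the two antipodal curves can occur.\<close>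

definition evolute ::
  "real set \<Rightarrow> (real \<Rightarrow> real^4) \<Rightarrow> (real \<Rightarrow> real^4) \<Rightarrow> (real \<Rightarrow> real^4) \<Rightarrow> real
     \<Rightarrow> (real \<Rightarrow> real) \<Rightarrow> (real \<Rightarrow> real) \<Rightarrow> (real \<Rightarrow> real) \<Rightarrow> real \<Rightarrow> real \<Rightarrow> real^4" where
  "evolute I \<gamma> f1 f2 e \<alpha> l n \<sigma> s =
     (\<sigma> / sqrt \<bar>g_fun I e \<alpha> l n s\<bar>) *\<^sub>R
       ((l s * n s) *\<^sub>R (n s *\<^sub>R \<gamma> s - \<alpha> s *\<^sub>R f2 s) - wronsk I \<alpha> n s *\<^sub>R f1 s)"

definition AdS_evolute_set ::
  "real set \<Rightarrow> (real \<Rightarrow> real^4) \<Rightarrow> (real \<Rightarrow> real^4) \<Rightarrow> (real \<Rightarrow> real^4) \<Rightarrow> real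
     \<Rightarrow> (real \<Rightarrow> real) \<Rightarrow> (real \<Rightarrow> real) \<Rightarrow> (real \<Rightarrow> real) \<Rightarrow> (real^4) set" where
  "AdS_evolute_set I \<gamma> f1 f2 e \<alpha> l n =
     {evolute I \<gamma> f1 f2 e \<alpha> l n \<sigma> s | \<sigma> s. \<sigma> \<in> {1, -1} \<and> s \<in> I \<and> g_fun I e \<alpha> l n s < 0}"


section \<open>Focal surfaces\<close>

definition eps_zeta :: "real \<Rightarrow> (real \<Rightarrow> real) \<Rightarrow> (real \<Rightarrow> real) \<Rightarrow> real \<Rightarrow> real" where
  "eps_zeta e \<alpha> n s = sgn (- (n s)\<^sup>2 - e * (\<alpha> s)\<^sup>2)"

definition zeta ::
  "(real \<Rightarrow> real^4) \<Rightarrow> (real \<Rightarrow> real^4) \<Rightarrow> real \<Rightarrow> (real \<Rightarrow> real) \<Rightarrow> (real \<Rightarrow> real) \<Rightarrow> real \<Rightarrow> real^4" where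
  "zeta \<gamma> f2 e \<alpha> n s =
     (1 / sqrt (eps_zeta e \<alpha> n s * (- (n s)\<^sup>2 - e * (\<alpha> s)\<^sup>2))) *\<^sub>R
       (n s *\<^sub>R \<gamma> s - \<alpha> s *\<^sub>R f2 s)"

definition focal_surface ::
  "(real \<Rightarrow> real) \<times> (real \<Rightarrow> real) \<Rightarrow> (real \<Rightarrow> real^4) \<Rightarrow> (real \<Rightarrow> real^4) \<Rightarrow> real \<Rightarrow> real \<Rightarrow> real^4" where
  "focal_surface PR z f s \<theta> = fst PR \<theta> *\<^sub>R z s + snd PR \<theta> *\<^sub>R f s"

definition singular_at :: "real set \<Rightarrow> (real \<Rightarrow> real \<Rightarrow> real^4) \<Rightarrow> real \<Rightarrow> real \<Rightarrow> bool" where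
  "singular_at I F s \<theta> \<longleftrightarrow>
     triple_prod (F s \<theta>)
       (vector_derivative (\<lambda>t. F t \<theta>) (at s within I))
       (vector_derivative (\<lambda>t. F s t) (at \<theta>)) = 0"

definition singular_values :: "real set \<Rightarrow> (real \<Rightarrow> real \<Rightarrow> real^4) \<Rightarrow> (real^4) set" where
  "singular_values I F = {F s \<theta> | s \<theta>. s \<in> I \<and> singular_at I F s \<theta>}"

end

(* The focal surface F = P zeta + R f1 has F and its theta-derivative spanning the plane of zeta and
   f1, so it is singular exactly where the s-derivative is tangent to the span of zeta, f1, i.e. where
   its (gamma, f2)-part is parallel to n gamma - alpha f2.  Writing W = alpha n' - n alpha' and
   K = l n sqrt |n^2 + e alpha^2|, this is the linear equation P W + R K = 0.  Since
   g = e W^2 + eps_zeta K^2 is the pseudo-norm of K zeta - W f1, the unit solutions (P, R) are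
   (K, -W) / sqrt |g| up to sign, and these give the evolute.  On the hyperbolic surfaces the sign is
   forced by cosh > 0; it is constant because g, and with it K or W, has no zero on the interval. *)
theory Submission
  imports Defs
begin

section \<open>The triple product\<close>

text \<open>The permutations of the four indices are decomposed one index at a time, down to the
  identity on \<open>{4}\<close>; regrouped, the 24 terms are the expansion along the first
  row.\<close>

lemma det_4:
  "det (A :: 'a::comm_ring_1^4^4) =
     A$1$1 * (A$2$2 * (A$3$3 * A$4$4 - A$3$4 * A$4$3) - A$2$3 * (A$3$2 * A$4$4 - A$3$4 * A$4$2) + A$2$4 * (A$3$2 * A$4$3 - A$3$3 * A$4$2))
   - A$1$2 * (A$2$1 * (A$3$3 * A$4$4 - A$3$4 * A$4$3) - A$2$3 * (A$3$1 * A$4$4 - A$3$4 * A$4$1) + A$2$4 * (A$3$1 * A$4$3 - A$3$3 * A$4$1))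
   + A$1$3 * (A$2$1 * (A$3$2 * A$4$4 - A$3$4 * A$4$2) - A$2$2 * (A$3$1 * A$4$4 - A$3$4 * A$4$1) + A$2$4 * (A$3$1 * A$4$2 - A$3$2 * A$4$1))
   - A$1$4 * (A$2$1 * (A$3$2 * A$4$3 - A$3$3 * A$4$2) - A$2$2 * (A$3$1 * A$4$3 - A$3$3 * A$4$1) + A$2$3 * (A$3$1 * A$4$2 - A$3$2 * A$4$1))"
proof -
  have f234: "finite {2::4, 3, 4}" "1 \<notin> {2::4, 3, 4}" by auto
  have f34: "finite {3::4, 4}" "2 \<notin> {3::4, 4}" by auto
  have f4: "finite {4::4}" "3 \<notin> {4::4}" by auto
  show ?thesis
    unfolding det_def UNIV_4
    unfolding sum_over_permutations_insert[OF f234]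
    unfolding sum_over_permutations_insert[OF f34]
    unfolding sum_over_permutations_insert[OF f4]
    unfolding permutes_sing
    by (simp add: sign_swap_id permutation_swap_id permutation_compose sign_compose sign_id swap_id_eq) (simp add: algebra_simps)
qed

text \<open>The coordinates are the cofactors of the first row of \<open>det (x, u, v, w)\<close>,
  with the sign reversed in the two coordinates where \<open>pip\<close> is negative; uniqueness in
  the definite description does the rest.\<close>

lemma triple_prod_eq:
  "triple_prod u v w = vector
   [- (u$2 * (v$3 * w$4 - v$4 * w$3) - u$3 * (v$2 * w$4 - v$4 * w$2) + u$4 * (v$2 * w$3 - v$3 * w$2)),
    u$1 * (v$3 * w$4 - v$4 * w$3) - u$3 * (v$1 * w$4 - v$4 * w$1) + u$4 * (v$1 * w$3 - v$3 * w$1),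
    u$1 * (v$2 * w$4 - v$4 * w$2) - u$2 * (v$1 * w$4 - v$4 * w$1) + u$4 * (v$1 * w$2 - v$2 * w$1),
    - (u$1 * (v$2 * w$3 - v$3 * w$2) - u$2 * (v$1 * w$3 - v$3 * w$1) + u$3 * (v$1 * w$2 - v$2 * w$1))]"
  (is "_ = ?y")
proof -
  have "\<forall>x. pip x ?y = det (vector [x, u, v, w] :: real^4^4)"
    by (simp add: pip_def det_4 vector_4_nth algebra_simps)
  then show ?thesis
    using ex1_triple_prod[of u v w] pip_triple_prod by metis
qed

text \<open>The right side is the Gram determinant of \<open>u\<close>, \<open>v\<close>,
  \<open>w\<close>. It enters with sign +1 because the metric, having two minus signs, has
  determinant 1.\<close>

lemma pip_triple_prod_self:
  "pip (triple_prod u v w) (triple_prod u v w) =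
     pip u u * (pip v v * pip w w - (pip v w)\<^sup>2) - pip u v * (pip u v * pip w w - pip v w * pip u w)
     + pip u w * (pip u v * pip v w - pip v v * pip u w)"
  unfolding triple_prod_eq pip_def vector_4_nth by (simp add: algebra_simps power2_eq_square)

text \<open>The product is trilinear and alternating, so the factor is the 3x3 determinant of
  coefficients. This turns the vanishing of a triple product into a scalar equation.\<close>

lemma triple_prod_combination:
  "triple_prod (a1 *\<^sub>R u + a2 *\<^sub>R v + a3 *\<^sub>R w) (b1 *\<^sub>R u + b2 *\<^sub>R v + b3 *\<^sub>R w)
      (c1 *\<^sub>R u + c2 *\<^sub>R v + c3 *\<^sub>R w)
    = (a1 * (b2 * c3 - b3 * c2) - a2 * (b1 * c3 - b3 * c1) + a3 * (b1 * c2 - b2 * c1)) *\<^sub>R triple_prod u v w"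
  by (simp add: triple_prod_eq vec_eq_iff forall_4 vector_4_nth) algebra

lemma pip_triple_prod_right:
  "pip u (triple_prod u v w) = 0" "pip v (triple_prod u v w) = 0" "pip w (triple_prod u v w) = 0"
  by (simp_all add: triple_prod_eq pip_def vector_4_nth algebra_simps)

lemma bounded_bilinear_pip: "bounded_bilinear pip"
  unfolding bilinear_conv_bounded_bilinear[symmetric]
  by (auto simp: bilinear_def linear_iff pip_def algebra_simps)

section \<open>Constant signs on connected sets, and the branch of the hyperbola reached by
  \<open>cosh\<close> and \<open>sinh\<close>\<close>

lemma constant_sign:
  fixes f :: "real \<Rightarrow> real"
  assumes I: "connected I" and f: "continuous_on I f" and nz: "\<And>s. s \<in> I \<Longrightarrow> f s \<noteq> 0"
  obtains \<sigma> where "\<sigma> \<in> {1, -1}" "\<And>s. s \<in> I \<Longrightarrow> sgn (f s) = \<sigma>"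
proof (cases "\<exists>s\<in>I. f s < 0")
  case False
  then show thesis
    using that[of 1] nz by (force simp: sgn_if)
next
  case True
  have "f s < 0" if "s \<in> I" for s
  proof (rule ccontr)
    assume "\<not> f s < 0"
    moreover have "connected (f ` I)"
      using connected_continuous_image f I by blast
    ultimately have "0 \<in> f ` I"
      using True that unfolding connected_iff_interval by (meson image_eqI less_imp_le not_less)
    then show False
      using nz by auto
  qed
  then show thesis
    using that[of "-1"] by simp
qed

text \<open>The parameter is \<open>arsinh R\<close>; the equation then determines
  \<open>cosh\<close> up to sign and positivity removes the ambiguity. The condition
  \<open>P > 0\<close> is what later discards one of the two antipodal evolutes.\<close>

lemma ex_cosh_sinh_iff: "(\<exists>\<theta>. cosh \<theta> = P \<and> sinh \<theta> = R) \<longleftrightarrow> P\<^sup>2 - R\<^sup>2 = 1 \<and> P > 0" for P R :: real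
proof
  assume "\<exists>\<theta>. cosh \<theta> = P \<and> sinh \<theta> = R"
  then show "P\<^sup>2 - R\<^sup>2 = 1 \<and> P > 0"
    by (auto simp: cosh_square_eq)
next
  assume "P\<^sup>2 - R\<^sup>2 = 1 \<and> P > 0"
  then have PR: "P\<^sup>2 - R\<^sup>2 = 1" "P > 0"
    by auto
  have "(cosh (arsinh R))\<^sup>2 = P\<^sup>2"
    unfolding cosh_square_eq sinh_arsinh_real using PR by linarith
  then have "cosh (arsinh R) = P"
    using PR by (intro power2_eq_imp_eq[OF _ cosh_real_nonneg]) linarith+
  then show "\<exists>\<theta>. cosh \<theta> = P \<and> sinh \<theta> = R"
    by (intro exI[of _ "arsinh R"]) simp
qed

section \<open>Singularities of the focal surfaces\<close>

locale regular_framed_immersion =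
  fixes I :: "real set" and \<gamma> f1 f2 :: "real \<Rightarrow> real^4"
    and \<alpha> l n :: "real \<Rightarrow> real" and e :: real
  assumes interval: "is_interval I" and interior: "interior I \<noteq> {}"
    and immersion: "spacelike_framed_immersion I \<gamma> f1 f2"
    and curvature: "has_curvature I \<gamma> f1 f2 e \<alpha> l n"
    and regular: "s \<in> I \<Longrightarrow> (\<alpha> s)\<^sup>2 + e * (n s)\<^sup>2 \<noteq> 0"
    and g_nonzero: "s \<in> I \<Longrightarrow> g_fun I e \<alpha> l n s \<noteq> 0"
begin

abbreviation \<mu> where "\<mu> \<equiv> frame_mu \<gamma> f1 f2"
abbreviation \<zeta> where "\<zeta> \<equiv> zeta \<gamma> f2 e \<alpha> n"
abbreviation \<epsilon> where "\<epsilon> \<equiv> eps_zeta e \<alpha> n"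
abbreviation g where "g \<equiv> g_fun I e \<alpha> l n"
abbreviation W where "W \<equiv> wronsk I \<alpha> n"
abbreviation E where "E \<equiv> evolute I \<gamma> f1 f2 e \<alpha> l n"
abbreviation v where "v s \<equiv> n s *\<^sub>R \<gamma> s - \<alpha> s *\<^sub>R f2 s"

text \<open>This is the pseudo-norm of \<open>v s\<close>, since \<gamma> and \<open>f2\<close> are
  orthogonal with pseudo-norms -1 and \<open>- e\<close>.\<close>

definition q where "q s = - (n s)\<^sup>2 - e * (\<alpha> s)\<^sup>2"
definition K where "K s = l s * n s * sqrt \<bar>q s\<bar>"

text \<open>A connected set with more than one point has no isolated point. Hence derivatives within
  \<open>I\<close> are unique, also at endpoints.\<close>

lemma within_neq_bot: "at s within I \<noteq> bot" if "s \<in> I"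
proof -
  have "I \<noteq> {s}"
    using interior by auto
  then show ?thesis
    using connected_imp_perfect[OF is_interval_connected[OF interval], of s] that interior
    by (auto simp: trivial_limit_within)
qed

lemma vector_derivative_eq:
  "(f has_vector_derivative f') (at s within I) \<Longrightarrow> s \<in> I \<Longrightarrow> vector_derivative f (at s within I) = f'"
  using vector_derivative_within within_neq_bot by blast

lemma frame_products:
  assumes "s \<in> I"
  shows "pip (\<gamma> s) (\<gamma> s) = -1" "pip (f1 s) (f1 s) = e" "pip (f2 s) (f2 s) = - e"
    "pip (\<gamma> s) (f1 s) = 0" "pip (\<gamma> s) (f2 s) = 0" "pip (f1 s) (f2 s) = 0"
    "pip (f1 s) (\<gamma> s) = 0" "pip (f2 s) (\<gamma> s) = 0" "pip (f2 s) (f1 s) = 0"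
    "pip (\<gamma> s) (\<mu> s) = 0" "pip (f1 s) (\<mu> s) = 0" "pip (f2 s) (\<mu> s) = 0"
    "pip (\<mu> s) (\<mu> s) = 1" and e_cases: "e = 1 \<or> e = -1"
proof -
  have comm: "pip x y = pip y x" for x y
    by (simp add: pip_def mult.commute)
  show 1: "pip (\<gamma> s) (\<gamma> s) = -1" "pip (\<gamma> s) (f1 s) = 0" "pip (\<gamma> s) (f2 s) = 0"
    using immersion assms by (auto simp: spacelike_framed_immersion_def AdS3_def)
  show 2: "pip (f1 s) (f1 s) = e"
    using curvature assms by (auto simp: has_curvature_def)
  \<comment> \<open>The two orders of the factors in \<open>Delta1\<close> correspond to
    \<open>e = -1\<close> and \<open>e = 1\<close>; in both, \<open>f2\<close> has the opposite
    pseudo-norm to \<open>f1\<close>.\<close>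
  show 3: "e = 1 \<or> e = -1" "pip (f1 s) (f2 s) = 0" "pip (f2 s) (f2 s) = - e"
    using immersion assms 2
    by (auto simp: spacelike_framed_immersion_def Delta1_AdS_S_def Delta1_S_AdS_def AdS3_def S32_def)
  show "pip (f1 s) (\<gamma> s) = 0" "pip (f2 s) (\<gamma> s) = 0" "pip (f2 s) (f1 s) = 0"
    using 1 3 comm by metis+
  show "pip (\<gamma> s) (\<mu> s) = 0" "pip (f1 s) (\<mu> s) = 0" "pip (f2 s) (\<mu> s) = 0"
    by (simp_all add: frame_mu_def pip_triple_prod_right)
  \<comment> \<open>The Gram matrix is diagonal with entries -1, \<open>e\<close>,
    \<open>- e\<close>, so its determinant is \<open>e * e = 1\<close>.\<close>
  show "pip (\<mu> s) (\<mu> s) = 1"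
    unfolding frame_mu_def pip_triple_prod_self using 1 2 3 by auto
qed

lemma q_nonzero: "q s \<noteq> 0" if "s \<in> I"
proof -
  have "q s = - e * ((\<alpha> s)\<^sup>2 + e * (n s)\<^sup>2)"
    using e_cases[OF that] by (auto simp: q_def)
  then show ?thesis
    using regular e_cases that by auto
qed

lemma eps_eq: "\<epsilon> s = sgn (q s)"
  by (simp add: eps_zeta_def q_def)

lemma zeta_eq: "\<zeta> s = (1 / sqrt \<bar>q s\<bar>) *\<^sub>R v s"
  by (simp add: zeta_def eps_eq q_def[symmetric] abs_sgn mult.commute)

lemma pip_combination:
  assumes "s \<in> I"
  shows "pip (P *\<^sub>R \<zeta> s + R *\<^sub>R f1 s) (P *\<^sub>R \<zeta> s + R *\<^sub>R f1 s) = P\<^sup>2 * \<epsilon> s + R\<^sup>2 * e"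
proof -
  interpret pip: bounded_bilinear pip by (rule bounded_bilinear_pip)
  have q0: "\<bar>q s\<bar> > 0"
    using q_nonzero[OF assms] by simp
  have v: "pip (v s) (v s) = q s" "pip (v s) (f1 s) = 0" "pip (f1 s) (v s) = 0"
    by (simp_all add: pip.diff_left pip.diff_right pip.scaleR_left pip.scaleR_right frame_products[OF assms] q_def power2_eq_square)
  have "q s / \<bar>q s\<bar> = \<epsilon> s"
    by (simp add: eps_eq sgn_div_norm[where 'a=real] divide_inverse mult.commute)
  moreover have "P * (P * q s) / \<bar>q s\<bar> = P * P * (q s / \<bar>q s\<bar>)"
    by simp
  ultimately show ?thesis
    using q0 frame_products(2)[OF assms]
    by (simp add: zeta_eq pip.add_left pip.add_right pip.scaleR_left pip.scaleR_right v power2_eq_square)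
qed

section \<open>Differentiability of the curvature functions\<close>

lemma curvature_derivatives:
  assumes "s \<in> I"
  shows "(\<gamma> has_vector_derivative \<alpha> s *\<^sub>R \<mu> s) (at s within I)"
    "(f1 has_vector_derivative l s *\<^sub>R f2 s) (at s within I)"
    "(f2 has_vector_derivative l s *\<^sub>R f1 s + n s *\<^sub>R \<mu> s) (at s within I)"
    "(\<mu> has_vector_derivative \<alpha> s *\<^sub>R \<gamma> s + (e * n s) *\<^sub>R f2 s) (at s within I)"
  using curvature assms by (auto simp: has_curvature_def)

text \<open>Smoothness is assumed of the frame only. The curvature functions inherit regularity
  because they are scalar products of the first derivatives of the frame with \<open>\<mu>\<close>
  or \<open>f2\<close>.\<close>

lemma curvature_C1:
  obtains \<alpha>' n' where
    "\<And>s. s \<in> I \<Longrightarrow> (\<alpha> has_real_derivative \<alpha>' s) (at s within I)"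
    "\<And>s. s \<in> I \<Longrightarrow> (n has_real_derivative n' s) (at s within I)"
    "continuous_on I \<alpha>'" "continuous_on I n'" "continuous_on I l"
proof -
  interpret pip: bounded_bilinear pip by (rule bounded_bilinear_pip)
  obtain D where D0: "\<And>s. s \<in> I \<Longrightarrow> D 0 s = (\<gamma> s, f1 s, f2 s)"
    and D: "\<And>k s. s \<in> I \<Longrightarrow> (D k has_vector_derivative D (Suc k) s) (at s within I)"
    using immersion unfolding spacelike_framed_immersion_def smooth_on_def by metis
  have D1: "D 1 s = (\<alpha> s *\<^sub>R \<mu> s, l s *\<^sub>R f2 s, l s *\<^sub>R f1 s + n s *\<^sub>R \<mu> s)" if "s \<in> I" for s
  proof -
    have "((\<lambda>s. (\<gamma> s, f1 s, f2 s)) has_vector_derivative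
        (\<alpha> s *\<^sub>R \<mu> s, l s *\<^sub>R f2 s, l s *\<^sub>R f1 s + n s *\<^sub>R \<mu> s)) (at s within I)"
      by (intro has_vector_derivative_Pair curvature_derivatives that)
    moreover have "((\<lambda>s. (\<gamma> s, f1 s, f2 s)) has_vector_derivative D 1 s) (at s within I)"
      using has_vector_derivative_transform[OF that _ D[OF that, of 0]] D0 by simp
    ultimately show ?thesis
      by (rule vector_derivative_unique_within[OF within_neq_bot[OF that], symmetric])
  qed
  have cont: "continuous_on I (D k)" for k
    using D by (rule continuous_on_vector_derivative)
  have cont_frame: "continuous_on I \<gamma>" "continuous_on I f1" "continuous_on I f2" "continuous_on I \<mu>"
    by (rule continuous_on_vector_derivative, erule curvature_derivatives)+
  \<comment> \<open>Pairing the frame equations with \<open>\<mu>\<close>, of pseudo-norm 1,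
    isolates \<alpha> and \<open>n\<close>; pairing with \<open>f2\<close>, of pseudo-norm
    \<open>- e\<close>, isolates \<open>l\<close> after division by \<open>- e\<close>, which is
    multiplication by \<open>- e\<close>.\<close>
  have \<alpha>_eq: "\<alpha> s = pip (fst (D 1 s)) (\<mu> s)" and n_eq: "n s = pip (snd (snd (D 1 s))) (\<mu> s)"
    and l_eq: "l s = - e * pip (fst (snd (D 1 s))) (f2 s)" if "s \<in> I" for s
    using e_cases[OF that] by (auto simp: D1 pip.add_left pip.scaleR_left frame_products that simp del: One_nat_def)
  \<comment> \<open>Product rule: the second derivative of the curve comes from \<open>D 2\<close>,
    the derivative of \<open>\<mu>\<close> from its frame equation.\<close>
  define \<alpha>' where "\<alpha>' s = pip (fst (D 1 s)) (\<alpha> s *\<^sub>R \<gamma> s + (e * n s) *\<^sub>R f2 s) + pip (fst (D 2 s)) (\<mu> s)" for s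
  define n' where "n' s = pip (snd (snd (D 1 s))) (\<alpha> s *\<^sub>R \<gamma> s + (e * n s) *\<^sub>R f2 s)
    + pip (snd (snd (D 2 s))) (\<mu> s)" for s
  have D2: "(D 1 has_vector_derivative D 2 s) (at s within I)" if "s \<in> I" for s
    using D[OF that, of 1] by (simp add: numeral_2_eq_2)
  have dfst: "((\<lambda>s. fst (D 1 s)) has_vector_derivative fst (D 2 s)) (at s within I)"
    and dsnd: "((\<lambda>s. snd (snd (D 1 s))) has_vector_derivative snd (snd (D 2 s))) (at s within I)"
    if "s \<in> I" for s
    using D2[OF that]
    by (intro bounded_linear.has_vector_derivative[OF bounded_linear_fst]
        bounded_linear.has_vector_derivative[OF bounded_linear_snd]; assumption)+
  have d\<alpha>: "(\<alpha> has_real_derivative \<alpha>' s) (at s within I)" if "s \<in> I" for s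
    using has_vector_derivative_transform[OF that _ pip.has_vector_derivative[OF dfst curvature_derivatives(4)], OF _ that that] \<alpha>_eq
    by (simp add: has_real_derivative_iff_has_vector_derivative \<alpha>'_def)
  have dn: "(n has_real_derivative n' s) (at s within I)" if "s \<in> I" for s
    using has_vector_derivative_transform[OF that _ pip.has_vector_derivative[OF dsnd curvature_derivatives(4)], OF _ that that] n_eq
    by (simp add: has_real_derivative_iff_has_vector_derivative n'_def)
  have cont_\<alpha>_n: "continuous_on I \<alpha>" "continuous_on I n"
    using d\<alpha> dn DERIV_continuous_on by blast+
  have "continuous_on I \<alpha>'" "continuous_on I n'"
    unfolding \<alpha>'_def n'_def
    by (intro continuous_intros pip.continuous_on cont cont_frame cont_\<alpha>_n)+
  moreover have "continuous_on I (\<lambda>s. - e * pip (fst (snd (D 1 s))) (f2 s))"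
    by (intro continuous_intros pip.continuous_on cont cont_frame)
  then have "continuous_on I l"
    using l_eq by (simp cong: continuous_on_cong)
  ultimately show thesis
    using d\<alpha> dn that by blast
qed

lemma wronsk_eq:
  assumes "(\<alpha> has_real_derivative \<alpha>') (at s within I)" "(n has_real_derivative n') (at s within I)" "s \<in> I"
  shows "W s = \<alpha> s * n' - n s * \<alpha>'"
  using assms vector_derivative_eq[of \<alpha> \<alpha>' s] vector_derivative_eq[of n n' s]
  by (simp add: wronsk_def has_real_derivative_iff_has_vector_derivative)

lemma continuous_W: "continuous_on I W" and continuous_K: "continuous_on I K"
proof -
  obtain \<alpha>' n' where d\<alpha>: "\<And>s. s \<in> I \<Longrightarrow> (\<alpha> has_real_derivative \<alpha>' s) (at s within I)"
    and dn: "\<And>s. s \<in> I \<Longrightarrow> (n has_real_derivative n' s) (at s within I)"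
    and c: "continuous_on I \<alpha>'" "continuous_on I n'" "continuous_on I l"
    using curvature_C1 by blast
  have c': "continuous_on I \<alpha>" "continuous_on I n"
    using d\<alpha> dn DERIV_continuous_on by blast+
  have "W s = \<alpha> s * n' s - n s * \<alpha>' s" if "s \<in> I" for s
    using wronsk_eq d\<alpha> dn that by blast
  moreover have "continuous_on I (\<lambda>s. \<alpha> s * n' s - n s * \<alpha>' s)"
    using c c' by (intro continuous_intros)
  ultimately show "continuous_on I W"
    by (simp cong: continuous_on_cong)
  show "continuous_on I K"
    unfolding K_def q_def using c c' by (intro continuous_intros)
qed

section \<open>The equation of the singular points\<close>

text \<open>The derivative \<open>c'\<close> of the normalising factor is left unspecified: it only contributes a
  multiple of \<open>v s\<close>, which drops out of the triple product below.\<close>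

lemma zeta_derivative:
  assumes "s \<in> I"
  obtains \<alpha>' n' c' where "W s = \<alpha> s * n' - n s * \<alpha>'"
    "(\<zeta> has_vector_derivative c' *\<^sub>R v s +
       (1 / sqrt \<bar>q s\<bar>) *\<^sub>R (n' *\<^sub>R \<gamma> s - (\<alpha> s * l s) *\<^sub>R f1 s - \<alpha>' *\<^sub>R f2 s)) (at s within I)"
proof -
  obtain \<alpha>' n' where "\<And>s. s \<in> I \<Longrightarrow> (\<alpha> has_real_derivative \<alpha>' s) (at s within I)"
    and "\<And>s. s \<in> I \<Longrightarrow> (n has_real_derivative n' s) (at s within I)"
    using curvature_C1 by metis
  note d\<alpha> = this(1)[OF assms] and dn = this(2)[OF assms]
  note W = wronsk_eq[OF d\<alpha> dn assms]
  \<comment> \<open>The contributions \<open>n * \<alpha>\<close> and \<open>- \<alpha> * n\<close>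
    along \<open>\<mu>\<close> cancel, so the derivative stays in the span of \<gamma>,
    \<open>f1\<close>, \<open>f2\<close>.\<close>
  have "(v has_vector_derivative n' s *\<^sub>R \<gamma> s - (\<alpha> s * l s) *\<^sub>R f1 s - \<alpha>' s *\<^sub>R f2 s) (at s within I)"
    by (rule has_vector_derivative_eq_rhs,
        (rule has_vector_derivative_diff has_vector_derivative_scaleR d\<alpha> dn curvature_derivatives assms)+)
      (simp add: algebra_simps)
  moreover obtain c' where "((\<lambda>s. 1 / sqrt \<bar>q s\<bar>) has_real_derivative c') (at s within I)"
  proof -
    have "(q has_real_derivative - (2 * n s * n' s) - e * (2 * \<alpha> s * \<alpha>' s)) (at s within I)"
      unfolding q_def by (auto intro!: derivative_eq_intros d\<alpha> dn)
    then have dq2: "((\<lambda>s. (q s)\<^sup>2) has_real_derivative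
        2 * ((- (2 * n s * n' s) - e * (2 * \<alpha> s * \<alpha>' s)) * q s)) (at s within I)"
      by (auto intro!: derivative_eq_intros)
    have pos: "0 < (q s)\<^sup>2" "0 < sqrt ((q s)\<^sup>2)" "sqrt (sqrt ((q s)\<^sup>2)) \<noteq> 0"
      using q_nonzero[OF assms] by simp_all
    \<comment> \<open>Writing the absolute value as the root of a square makes the factor a
      composition of functions that are differentiable where \<open>q\<close> does not
      vanish.\<close>
    have eq: "1 / sqrt \<bar>q s\<bar> = inverse (sqrt (sqrt ((q s)\<^sup>2)))" for s
      by (simp add: divide_inverse)
    show thesis
      by (rule that, unfold eq, rule DERIV_inverse', rule DERIV_chain2[where f = sqrt],
          rule DERIV_real_sqrt[OF pos(2)], rule DERIV_chain2[where f = sqrt],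
          rule DERIV_real_sqrt[OF pos(1)], rule dq2, rule pos(3))
  qed
  ultimately have "((\<lambda>s. (1 / sqrt \<bar>q s\<bar>) *\<^sub>R v s) has_vector_derivative (1 / sqrt \<bar>q s\<bar>) *\<^sub>R
      (n' s *\<^sub>R \<gamma> s - (\<alpha> s * l s) *\<^sub>R f1 s - \<alpha>' s *\<^sub>R f2 s) + c' *\<^sub>R v s) (at s within I)"
    by (intro has_vector_derivative_scaleR)
  then show thesis
    using that[OF W] by (simp add: zeta_eq[abs_def] add.commute)
qed

text \<open>All three vectors lie in the span of \<gamma>, \<open>f1\<close>, \<open>f2\<close>, so
  their triple product is a scalar times \<open>\<mu>\<close>. The scalar factors into the Wronskian
  of \<open>(P, R)\<close>, nonzero by \<open>det\<close>, a positive square, and the stated linear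
  form.\<close>

lemma singular_iff:
  assumes s: "s \<in> I" and P: "(P has_real_derivative P') (at \<theta>)" and R: "(R has_real_derivative R') (at \<theta>)"
    and det: "P \<theta> * R' - R \<theta> * P' \<noteq> 0"
  shows "singular_at I (focal_surface (P, R) \<zeta> f1) s \<theta> \<longleftrightarrow> P \<theta> * W s + R \<theta> * K s = 0"
proof -
  obtain \<alpha>' n' c' where W: "W s = \<alpha> s * n' - n s * \<alpha>'"
    and d\<zeta>: "(\<zeta> has_vector_derivative c' *\<^sub>R v s +
       (1 / sqrt \<bar>q s\<bar>) *\<^sub>R (n' *\<^sub>R \<gamma> s - (\<alpha> s * l s) *\<^sub>R f1 s - \<alpha>' *\<^sub>R f2 s)) (at s within I)"
    using zeta_derivative[OF s] by blast
  define c where "c = 1 / sqrt \<bar>q s\<bar>"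
  have c: "c * sqrt \<bar>q s\<bar> = 1" "c \<noteq> 0"
    using q_nonzero[OF s] by (auto simp: c_def)
  let ?F = "focal_surface (P, R) \<zeta> f1"
  let ?T = "\<lambda>a b c. a *\<^sub>R \<gamma> s + b *\<^sub>R f1 s + c *\<^sub>R f2 s"
  have F: "?F s \<theta> = ?T (P \<theta> * c * n s) (R \<theta>) (- P \<theta> * c * \<alpha> s)"
    by (simp add: focal_surface_def zeta_eq c_def algebra_simps)
  have "((\<lambda>t. ?F t \<theta>) has_vector_derivative
      ?T (P \<theta> * (c' * n s + c * n')) (- P \<theta> * c * \<alpha> s * l s)
        (R \<theta> * l s - P \<theta> * (c' * \<alpha> s + c * \<alpha>'))) (at s within I)"
    unfolding focal_surface_def fst_conv snd_conv
    by (rule has_vector_derivative_eq_rhs, rule has_vector_derivative_add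
          [OF bounded_linear.has_vector_derivative[OF bounded_linear_scaleR_right d\<zeta>]
              bounded_linear.has_vector_derivative[OF bounded_linear_scaleR_right curvature_derivatives(2)[OF s]]])
      (simp add: c_def algebra_simps)
  then have Fs: "vector_derivative (\<lambda>t. ?F t \<theta>) (at s within I) =
      ?T (P \<theta> * (c' * n s + c * n')) (- P \<theta> * c * \<alpha> s * l s)
        (R \<theta> * l s - P \<theta> * (c' * \<alpha> s + c * \<alpha>'))"
    using vector_derivative_eq s by blast
  have "(?F s has_vector_derivative ?T (P' * c * n s) R' (- P' * c * \<alpha> s)) (at \<theta>)"
    unfolding focal_surface_def fst_conv snd_conv
    by (rule has_vector_derivative_eq_rhs, (rule has_vector_derivative_add has_vector_derivative_scaleR P R has_vector_derivative_const)+)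
      (simp add: zeta_eq c_def algebra_simps)
  then have Ft: "vector_derivative (?F s) (at \<theta>) = ?T (P' * c * n s) R' (- P' * c * \<alpha> s)"
    by (rule vector_derivative_at)
  have "\<mu> s \<noteq> 0"
    using frame_products(13)[OF s] by (auto simp: pip_def)
  \<comment> \<open>The 3x3 determinant of the coefficients found above, in the shape delivered by
    \<open>triple_prod_combination\<close>.\<close>
  define D where "D = (P \<theta> * c * n s) * ((- P \<theta> * c * \<alpha> s * l s) * (- P' * c * \<alpha> s) - (R \<theta> * l s - P \<theta> * (c' * \<alpha> s + c * \<alpha>')) * R')
    - R \<theta> * ((P \<theta> * (c' * n s + c * n')) * (- P' * c * \<alpha> s) - (R \<theta> * l s - P \<theta> * (c' * \<alpha> s + c * \<alpha>')) * (P' * c * n s))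
    + (- P \<theta> * c * \<alpha> s) * ((P \<theta> * (c' * n s + c * n')) * R' - (- P \<theta> * c * \<alpha> s * l s) * (P' * c * n s))"
  have "D = - (P \<theta> * R' - R \<theta> * P') * (P \<theta> * c\<^sup>2 * W s + R \<theta> * (l s * n s * c))"
    unfolding D_def W by algebra
  \<comment> \<open>Since \<open>c\<close> is the reciprocal of the root in \<open>K\<close>, this
    extracts the common factor \<open>c\<^sup>2\<close> from both summands.\<close>
  also have "l s * n s * c = c\<^sup>2 * K s"
    using c by (simp add: K_def power2_eq_square)
  finally have "D = - (P \<theta> * R' - R \<theta> * P') * c\<^sup>2 * (P \<theta> * W s + R \<theta> * K s)"
    by (simp add: algebra_simps)
  moreover have "singular_at I ?F s \<theta> \<longleftrightarrow> D = 0"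
    unfolding singular_at_def Fs Ft unfolding F triple_prod_combination frame_mu_def[symmetric] D_def[symmetric]
    using \<open>\<mu> s \<noteq> 0\<close> by simp
  ultimately show ?thesis
    using c det by simp
qed

section \<open>The evolute as normalised solution of the singularity equation\<close>

lemma g_eq: "g s = e * (W s)\<^sup>2 + \<epsilon> s * (K s)\<^sup>2"
proof -
  have "\<epsilon> s * \<bar>q s\<bar> = q s"
    by (simp add: eps_eq sgn_mult_abs)
  then have "\<epsilon> s * (K s)\<^sup>2 = (l s)\<^sup>2 * (n s)\<^sup>2 * q s"
    by (simp add: K_def power_mult_distrib)
  then show ?thesis
    by (simp add: g_fun_def q_def algebra_simps)
qed

lemma evolute_eq:
  assumes "s \<in> I"
  shows "E \<sigma> s = (\<sigma> / sqrt \<bar>g s\<bar> * K s) *\<^sub>R \<zeta> s + (- \<sigma> / sqrt \<bar>g s\<bar> * W s) *\<^sub>R f1 s"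
proof -
  have "(l s * n s) *\<^sub>R v s = K s *\<^sub>R \<zeta> s"
    using q_nonzero[OF assms] by (simp add: K_def zeta_eq)
  then show ?thesis
    by (simp add: evolute_def scaleR_diff_right)
qed

lemma evolute_level:
  assumes "s \<in> I" "\<sigma> \<in> {1, -1}"
  shows "(\<sigma> / sqrt \<bar>g s\<bar> * K s)\<^sup>2 * \<epsilon> s + (- \<sigma> / sqrt \<bar>g s\<bar> * W s)\<^sup>2 * e = sgn (g s)"
proof -
  have "\<sigma>\<^sup>2 = 1"
    using assms by auto
  then have "(\<sigma> / sqrt \<bar>g s\<bar> * K s)\<^sup>2 * \<epsilon> s + (- \<sigma> / sqrt \<bar>g s\<bar> * W s)\<^sup>2 * e = g s / \<bar>g s\<bar>"
    by (simp add: power_mult_distrib power_divide g_eq add_divide_distrib mult.commute)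
  then show ?thesis
    by (simp add: real_sgn_eq)
qed

text \<open>The kernel of the linear form is the line through \<open>(K, - W)\<close>, a nonzero
  vector because \<open>g\<close> is nonzero. On this line the pseudo-norm is a square times
  \<open>g\<close>, so the normalisation leaves only a sign.\<close>

lemma kernel_unit_vector:
  assumes s: "s \<in> I" and ker: "P * W s + R * K s = 0" and unit: "\<bar>P\<^sup>2 * \<epsilon> s + R\<^sup>2 * e\<bar> = 1"
  obtains \<sigma> where "\<sigma> \<in> {1, -1}" "P = \<sigma> / sqrt \<bar>g s\<bar> * K s" "R = - \<sigma> / sqrt \<bar>g s\<bar> * W s"
proof -
  have g: "g s \<noteq> 0"
    using g_nonzero s .
  then have "K s \<noteq> 0 \<or> W s \<noteq> 0"
    by (auto simp: g_eq)
  then have KW: "(K s)\<^sup>2 + (W s)\<^sup>2 \<noteq> 0"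
    by (simp add: sum_power2_eq_zero_iff)
  \<comment> \<open>The coefficient of the Euclidean orthogonal projection of \<open>(P, R)\<close>
    onto \<open>(K, - W)\<close>.\<close>
  define c where "c = (P * K s - R * W s) / ((K s)\<^sup>2 + (W s)\<^sup>2)"
  have c: "c * ((K s)\<^sup>2 + (W s)\<^sup>2) = P * K s - R * W s"
    using KW by (simp add: c_def)
  have "(P - c * K s) * ((K s)\<^sup>2 + (W s)\<^sup>2) = 0" "(R + c * W s) * ((K s)\<^sup>2 + (W s)\<^sup>2) = 0"
    using c ker by algebra+
  then have "P - c * K s = 0" "R + c * W s = 0"
    using KW mult_eq_0_iff by blast+
  then have PR: "P = c * K s" "R = - c * W s"
    by (simp_all add: eq_neg_iff_add_eq_0)
  have "P\<^sup>2 * \<epsilon> s + R\<^sup>2 * e = c\<^sup>2 * g s"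
    by (simp add: PR g_eq power2_eq_square algebra_simps)
  then have "(c * sqrt \<bar>g s\<bar>)\<^sup>2 = 1"
    using unit by (simp add: power_mult_distrib abs_mult)
  then have "c * sqrt \<bar>g s\<bar> \<in> {1, -1}"
    by (simp add: power2_eq_1_iff)
  then show thesis
    using that[of "c * sqrt \<bar>g s\<bar>"] g PR by simp
qed

text \<open>Each singular point is one of two antipodal evolute points. The condition on \<theta>
  remains because a hyperbolic parametrisation may miss one or both of them; only there do the
  surfaces differ.\<close>

lemma singular_values_eq:
  assumes P: "\<And>\<theta>. (P has_real_derivative P' \<theta>) (at \<theta>)" and R: "\<And>\<theta>. (R has_real_derivative R' \<theta>) (at \<theta>)"
    and det: "\<And>\<theta>. P \<theta> * R' \<theta> - R \<theta> * P' \<theta> \<noteq> 0"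
    and unit: "\<And>s \<theta>. s \<in> I \<Longrightarrow> \<bar>(P \<theta>)\<^sup>2 * \<epsilon> s + (R \<theta>)\<^sup>2 * e\<bar> = 1"
  shows "singular_values I (focal_surface (P, R) \<zeta> f1) =
    {E \<sigma> s | \<sigma> s. \<sigma> \<in> {1, -1} \<and> s \<in> I \<and>
       (\<exists>\<theta>. P \<theta> = \<sigma> / sqrt \<bar>g s\<bar> * K s \<and> R \<theta> = - \<sigma> / sqrt \<bar>g s\<bar> * W s)}"
proof (intro subset_antisym subsetI)
  fix x
  assume "x \<in> singular_values I (focal_surface (P, R) \<zeta> f1)"
  then obtain s \<theta> where s: "s \<in> I" and x: "x = P \<theta> *\<^sub>R \<zeta> s + R \<theta> *\<^sub>R f1 s"
    and ker: "P \<theta> * W s + R \<theta> * K s = 0"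
    unfolding singular_values_def using singular_iff[OF _ P R det] by (auto simp: focal_surface_def)
  from kernel_unit_vector[OF s ker unit[OF s]] obtain \<sigma> where
    "\<sigma> \<in> {1, -1}" "P \<theta> = \<sigma> / sqrt \<bar>g s\<bar> * K s" "R \<theta> = - \<sigma> / sqrt \<bar>g s\<bar> * W s" .
  then show "x \<in> {E \<sigma> s | \<sigma> s. \<sigma> \<in> {1, -1} \<and> s \<in> I \<and>
       (\<exists>\<theta>. P \<theta> = \<sigma> / sqrt \<bar>g s\<bar> * K s \<and> R \<theta> = - \<sigma> / sqrt \<bar>g s\<bar> * W s)}"
    using s x evolute_eq[OF s, of \<sigma>] by (intro CollectI exI[of _ \<sigma>] exI[of _ s]) auto
next
  fix x
  assume "x \<in> {E \<sigma> s | \<sigma> s. \<sigma> \<in> {1, -1} \<and> s \<in> I \<and>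
       (\<exists>\<theta>. P \<theta> = \<sigma> / sqrt \<bar>g s\<bar> * K s \<and> R \<theta> = - \<sigma> / sqrt \<bar>g s\<bar> * W s)}"
  then obtain \<sigma> s \<theta> where s: "s \<in> I" and x: "x = E \<sigma> s"
    and PR: "P \<theta> = \<sigma> / sqrt \<bar>g s\<bar> * K s" "R \<theta> = - \<sigma> / sqrt \<bar>g s\<bar> * W s"
    by blast
  have "x = focal_surface (P, R) \<zeta> f1 s \<theta>"
    by (simp add: focal_surface_def x evolute_eq[OF s] PR)
  moreover have "singular_at I (focal_surface (P, R) \<zeta> f1) s \<theta>"
    unfolding singular_iff[OF s P R det] by (simp add: PR)
  ultimately show "x \<in> singular_values I (focal_surface (P, R) \<zeta> f1)"
    using s by (auto simp: singular_values_def)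
qed

lemma pip_zeta: "s \<in> I \<Longrightarrow> pip (\<zeta> s) (\<zeta> s) = \<epsilon> s"
  using pip_combination[of s 1 0] by simp

lemma pip_focal_surface:
  "s \<in> I \<Longrightarrow> pip (focal_surface (P, R) \<zeta> f1 s \<theta>) (focal_surface (P, R) \<zeta> f1 s \<theta>) = (P \<theta>)\<^sup>2 * \<epsilon> s + (R \<theta>)\<^sup>2 * e"
  by (simp add: focal_surface_def pip_combination)

lemma pip_evolute: "s \<in> I \<Longrightarrow> \<sigma> \<in> {1, -1} \<Longrightarrow> pip (E \<sigma> s) (E \<sigma> s) = sgn (g s)"
  by (simp only: evolute_eq pip_combination evolute_level)

lemma nonempty: "\<exists>s. s \<in> I"
  using interior interior_subset by blast

section \<open>Case 1: the compact focal surface\<close>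

text \<open>For \<open>e = 1\<close> the quantity under the sign is minus a sum of squares, so
  \<open>\<epsilon> s\<close> could not be 1.\<close>

lemma timelike_case:
  assumes "s \<in> I" and eps: "\<epsilon> s * e = 1"
  shows "e = -1" and "\<epsilon> s = -1"
proof -
  have "e \<noteq> 1"
  proof
    assume e: "e = 1"
    have "- (n s)\<^sup>2 - (\<alpha> s)\<^sup>2 \<le> 0"
      using sum_power2_ge_zero[of "n s" "\<alpha> s"] by linarith
    moreover have "sgn x \<le> 0" if "x \<le> 0" for x :: real
      using that by (simp add: sgn_if)
    ultimately have "\<epsilon> s \<le> 0"
      unfolding eps_zeta_def e mult_1_left by blast
    then show False
      using eps e by simp
  qed
  then show e: "e = -1"
    using e_cases assms by blast
  show "\<epsilon> s = -1"
    using eps unfolding e by simp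
qed

text \<open>With both signs equal to -1, \<open>g\<close> is minus a sum of squares and the whole
  evolute lies in \<open>AdS3\<close>. Every point of the unit circle is some
  \<open>(cos \<theta>, sin \<theta>)\<close>, so both signs of the evolute occur.\<close>

lemma singular_values_compact:
  assumes eps: "\<And>s. s \<in> I \<Longrightarrow> \<epsilon> s * e = 1"
  shows "s \<in> I \<Longrightarrow> timelike (\<zeta> s) \<and> timelike (f1 s)"
    and "s \<in> I \<Longrightarrow> focal_surface (cos, sin) \<zeta> f1 s \<theta> \<in> AdS3"
    and "s \<in> I \<Longrightarrow> g s < 0"
    and "singular_values I (focal_surface (cos, sin) \<zeta> f1) = AdS_evolute_set I \<gamma> f1 f2 e \<alpha> l n"
proof -
  have e: "e = -1" and \<epsilon>: "\<And>s. s \<in> I \<Longrightarrow> \<epsilon> s = -1"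
    using timelike_case eps nonempty by blast+
  show "s \<in> I \<Longrightarrow> timelike (\<zeta> s) \<and> timelike (f1 s)"
    by (simp add: timelike_def pip_zeta frame_products \<epsilon>) (simp add: e)
  have norm: "(cos \<theta>)\<^sup>2 * \<epsilon> s + (sin \<theta>)\<^sup>2 * e = -1" if "s \<in> I" for \<theta> s
    unfolding \<epsilon>[OF that] unfolding e using sin_cos_squared_add[of \<theta>] by linarith
  then show "s \<in> I \<Longrightarrow> focal_surface (cos, sin) \<zeta> f1 s \<theta> \<in> AdS3"
    by (simp only: AdS3_def pip_focal_surface mem_Collect_eq)
  have g: "g s < 0" if "s \<in> I" for s
  proof -
    have "g s = - (W s)\<^sup>2 - (K s)\<^sup>2"
      unfolding g_eq \<epsilon>[OF that] by (simp add: e)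
    then show ?thesis
      using g_nonzero[OF that] sum_power2_ge_zero[of "W s" "K s"] by linarith
  qed
  then show "s \<in> I \<Longrightarrow> g s < 0" .
  have sol: "\<exists>\<theta>. cos \<theta> = \<sigma> / sqrt \<bar>g s\<bar> * K s \<and> sin \<theta> = - \<sigma> / sqrt \<bar>g s\<bar> * W s"
    if "s \<in> I" "\<sigma> \<in> {1, -1}" for \<sigma> s
  proof -
    have "(\<sigma> / sqrt \<bar>g s\<bar> * K s)\<^sup>2 + (- \<sigma> / sqrt \<bar>g s\<bar> * W s)\<^sup>2 = 1"
      using evolute_level[OF that] unfolding \<epsilon>[OF that(1)] sgn_neg[OF g[OF that(1)]]
      unfolding e by simp
    then show ?thesis
      using sincos_total_2pi by metis
  qed
  have unit: "\<bar>(cos \<theta>)\<^sup>2 * \<epsilon> s + (sin \<theta>)\<^sup>2 * e\<bar> = 1" if "s \<in> I" for \<theta> s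
    using norm[OF that] by simp
  have det: "cos \<theta> * cos \<theta> - sin \<theta> * - sin \<theta> \<noteq> 0" for \<theta> :: real
    using sin_cos_squared_add[of \<theta>] by (simp add: power2_eq_square)
  show "singular_values I (focal_surface (cos, sin) \<zeta> f1) = AdS_evolute_set I \<gamma> f1 f2 e \<alpha> l n"
    unfolding AdS_evolute_set_def
    by (rule trans[OF singular_values_eq[OF DERIV_cos DERIV_sin det unit]])
      (use g sol in \<open>blast+\<close>)
qed

section \<open>Case 2: the hyperbolic focal surfaces\<close>

text \<open>Here \<open>g = e * (W\<^sup>2 - K\<^sup>2)\<close>, and its constant sign
  \<open>c\<close> decides which of \<open>K\<close>, \<open>W\<close> dominates: the
  \<open>(cosh, sinh)\<close> surface requires \<open>K\<close> to dominate, the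
  \<open>(sinh, cosh)\<close> surface \<open>W\<close>. The other surface has no singular
  point.\<close>

lemma singular_values_hyperbolic:
  assumes eps: "\<And>s. s \<in> I \<Longrightarrow> \<epsilon> s * e = -1"
  obtains \<sigma> c where "\<sigma> \<in> {1, -1}" "c \<in> {1, -1}" "\<And>s. s \<in> I \<Longrightarrow> sgn (g s) = c"
    "singular_values I (focal_surface (cosh, sinh) \<zeta> f1) = (if c = - e then E \<sigma> ` I else {})"
    "singular_values I (focal_surface (sinh, cosh) \<zeta> f1) = (if c = e then E \<sigma> ` I else {})"
proof -
  have e: "e \<in> {1, -1}"
    using e_cases nonempty by blast
  have \<epsilon>: "\<epsilon> s = - e" if "s \<in> I" for s
    using eps[OF that] e by auto
  have g: "g s = e * ((W s)\<^sup>2 - (K s)\<^sup>2)" if "s \<in> I" for s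
    by (simp add: g_eq \<epsilon> that algebra_simps)
  have conn: "connected I"
    using interval is_interval_connected by blast
  have "continuous_on I (\<lambda>s. e * ((W s)\<^sup>2 - (K s)\<^sup>2))"
    by (intro continuous_intros continuous_W continuous_K)
  then have "continuous_on I g"
    using g by (simp cong: continuous_on_cong)
  then obtain c where c: "c \<in> {1, -1}" and sgn_g: "\<And>s. s \<in> I \<Longrightarrow> sgn (g s) = c"
    using constant_sign[OF conn] g_nonzero by metis
  \<comment> \<open>The pseudo-norm of the evolute, multiplied by \<open>- e\<close>; it shows which
    hyperbola contains its coefficient pair.\<close>
  have level: "(\<tau> / sqrt \<bar>g s\<bar> * K s)\<^sup>2 - (- \<tau> / sqrt \<bar>g s\<bar> * W s)\<^sup>2 = - c * e"
    if "s \<in> I" "\<tau> \<in> {1, -1}" for \<tau> s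
    using evolute_level[OF that] sgn_g[OF that(1)] \<epsilon>[OF that(1)] e by auto
  have pos: "\<tau> / sqrt \<bar>g s\<bar> * x > 0 \<longleftrightarrow> \<tau> * x > 0" if "s \<in> I" for \<tau> s x
    using g_nonzero[OF that] by (simp add: zero_less_mult_iff zero_less_divide_iff divide_less_0_iff)
  have unit: "\<bar>(cosh \<theta>)\<^sup>2 * \<epsilon> s + (sinh \<theta>)\<^sup>2 * e\<bar> = 1" "\<bar>(sinh \<theta>)\<^sup>2 * \<epsilon> s + (cosh \<theta>)\<^sup>2 * e\<bar> = 1"
    if "s \<in> I" for \<theta> s
    using e by (auto simp: \<epsilon> that cosh_square_eq)
  have det: "cosh \<theta> * cosh \<theta> - sinh \<theta> * sinh \<theta> \<noteq> 0" "sinh \<theta> * sinh \<theta> - cosh \<theta> * cosh \<theta> \<noteq> 0" for \<theta> :: real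
    using cosh_square_eq[of \<theta>] by (simp_all add: power2_eq_square)
  have dcosh: "(cosh has_real_derivative sinh \<theta>) (at \<theta>)"
    and dsinh: "(sinh has_real_derivative cosh \<theta>) (at \<theta>)" for \<theta> :: real
    by (auto intro!: derivative_eq_intros)
  have cosh_iff: "(\<exists>\<theta>. cosh \<theta> = \<tau> / sqrt \<bar>g s\<bar> * K s \<and> sinh \<theta> = - \<tau> / sqrt \<bar>g s\<bar> * W s)
      \<longleftrightarrow> c = - e \<and> \<tau> * K s > 0" if "s \<in> I" "\<tau> \<in> {1, -1}" for s \<tau>
    unfolding ex_cosh_sinh_iff level[OF that] pos[OF that(1)] using c e by auto
  have sv_cosh: "singular_values I (focal_surface (cosh, sinh) \<zeta> f1) =
      {E \<tau> s | \<tau> s. \<tau> \<in> {1, -1} \<and> s \<in> I \<and> c = - e \<and> \<tau> * K s > 0}"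
    by (rule trans[OF singular_values_eq[OF dcosh dsinh det(1) unit(1)]])
      (use cosh_iff in \<open>blast+\<close>)
  have level': "(- \<tau> / sqrt \<bar>g s\<bar> * W s)\<^sup>2 - (\<tau> / sqrt \<bar>g s\<bar> * K s)\<^sup>2 = c * e"
    if "s \<in> I" "\<tau> \<in> {1, -1}" for \<tau> s
    using level[OF that] by linarith
  have sinh_iff: "(\<exists>\<theta>. sinh \<theta> = \<tau> / sqrt \<bar>g s\<bar> * K s \<and> cosh \<theta> = - \<tau> / sqrt \<bar>g s\<bar> * W s)
      \<longleftrightarrow> c = e \<and> \<tau> * - W s > 0" if "s \<in> I" "\<tau> \<in> {1, -1}" for s \<tau>
    unfolding conj_commute[of "sinh _ = _"] ex_cosh_sinh_iff level'[OF that] pos[OF that(1)]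
    using c e by auto
  have sv_sinh: "singular_values I (focal_surface (sinh, cosh) \<zeta> f1) =
      {E \<tau> s | \<tau> s. \<tau> \<in> {1, -1} \<and> s \<in> I \<and> c = e \<and> \<tau> * - W s > 0}"
    by (rule trans[OF singular_values_eq[OF dsinh dcosh det(2) unit(2)]])
      (use sinh_iff in \<open>blast+\<close>)
  \<comment> \<open>A function without zeros has constant sign on the interval, so requiring
    \<open>\<tau> * f s > 0\<close> picks the same sign at every parameter. It is applied to
    \<open>K\<close> and to \<open>- W\<close>, the coefficients that must be values of
    \<open>cosh\<close>.\<close>
  have select: "\<exists>\<sigma>\<in>{1, -1}. {E \<tau> s | \<tau> s. \<tau> \<in> {1, -1} \<and> s \<in> I \<and> \<tau> * f s > 0} = E \<sigma> ` I"
    if cont: "continuous_on I f" and nz: "\<And>s. s \<in> I \<Longrightarrow> f s \<noteq> 0" for f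
  proof -
    obtain \<sigma> where \<sigma>: "\<sigma> \<in> {1, -1}" "\<And>s. s \<in> I \<Longrightarrow> sgn (f s) = \<sigma>"
      using constant_sign[OF conn cont nz] by blast
    have "\<tau> * f s > 0 \<longleftrightarrow> \<tau> = \<sigma>" if "s \<in> I" "\<tau> \<in> {1, -1}" for s \<tau>
      using \<sigma>(1) \<sigma>(2)[OF that(1)] that(2) by (auto simp: sgn_if split: if_splits)
    then have "{E \<tau> s | \<tau> s. \<tau> \<in> {1, -1} \<and> s \<in> I \<and> \<tau> * f s > 0} =
        {E \<tau> s | \<tau> s. \<tau> \<in> {1, -1} \<and> s \<in> I \<and> \<tau> = \<sigma>}"
      by blast
    also have "\<dots> = E \<sigma> ` I"
      using \<sigma>(1) by blast
    finally show ?thesis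
      using \<sigma>(1) by blast
  qed
  consider "c = - e" "c \<noteq> e" | "c = e" "c \<noteq> - e"
    using c e by auto
  then show thesis
  proof cases
    case 1
    \<comment> \<open>By \<open>level\<close> the squared coefficient of \<zeta> exceeds a square by
      1, which is impossible if it is zero.\<close>
    have "K s \<noteq> 0" if "s \<in> I" for s
    proof
      assume "K s = 0"
      moreover have "- c * e = 1"
        using 1 e by auto
      ultimately show False
        using level[OF that, of 1] zero_le_power2[of "- 1 / sqrt \<bar>g s\<bar> * W s"] by simp
    qed
    then obtain \<sigma> where "\<sigma> \<in> {1, -1}"
      "{E \<tau> s | \<tau> s. \<tau> \<in> {1, -1} \<and> s \<in> I \<and> \<tau> * K s > 0} = E \<sigma> ` I"
      using select[OF continuous_K] by blast
    then show thesis
      using that[of \<sigma> c] c sgn_g sv_cosh sv_sinh 1 by simp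
  next
    case 2
    have "- W s \<noteq> 0" if "s \<in> I" for s
    proof
      assume "- W s = 0"
      moreover have "c * e = 1"
        using 2 e by auto
      ultimately show False
        using level'[OF that, of 1] zero_le_power2[of "1 / sqrt \<bar>g s\<bar> * K s"] by simp
    qed
    then obtain \<sigma> where "\<sigma> \<in> {1, -1}"
      "{E \<tau> s | \<tau> s. \<tau> \<in> {1, -1} \<and> s \<in> I \<and> \<tau> * - W s > 0} = E \<sigma> ` I"
      using select[OF continuous_on_minus[OF continuous_W]] by blast
    then show thesis
      using that[of \<sigma> c] c sgn_g sv_cosh sv_sinh 2 by simp
  qed
qed

text \<open>The two surfaces lie in the quadrics of level \<open>- e\<close> and \<open>e\<close>,
  and the evolute in that of level \<open>c\<close>. Intersecting the evolute with a quadric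
  therefore gives all of it or nothing, matching the two alternatives for the singular
  values.\<close>

lemma singular_values_hyperbolic_levels:
  assumes eps: "\<And>s. s \<in> I \<Longrightarrow> \<epsilon> s * e = -1"
  shows "\<exists>\<sigma>\<in>{1, -1}.
     (\<Union>PR\<in>{(cosh, sinh), (sinh, cosh)}. singular_values I (focal_surface PR \<zeta> f1)) = E \<sigma> ` I \<and>
     (\<forall>PR\<in>{(cosh, sinh), (sinh, cosh)}. \<exists>M\<in>{AdS3, S32}.
        (\<forall>s\<in>I. \<forall>\<theta>. focal_surface PR \<zeta> f1 s \<theta> \<in> M) \<and>
        singular_values I (focal_surface PR \<zeta> f1) = E \<sigma> ` I \<inter> M)"
proof -
  obtain \<sigma> c where \<sigma>: "\<sigma> \<in> {1, -1}" and c: "c \<in> {1, -1}" and sgn_g: "\<And>s. s \<in> I \<Longrightarrow> sgn (g s) = c"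
    and sv: "singular_values I (focal_surface (cosh, sinh) \<zeta> f1) = (if c = - e then E \<sigma> ` I else {})"
    "singular_values I (focal_surface (sinh, cosh) \<zeta> f1) = (if c = e then E \<sigma> ` I else {})"
    using singular_values_hyperbolic[OF eps] by metis
  have e: "e \<in> {1, -1}"
    using e_cases nonempty by blast
  have \<epsilon>: "\<epsilon> s = - e" if "s \<in> I" for s
    using eps[OF that] e by auto
  define level where "level x = {u. pip u u = x}" for x
  have level: "level x \<in> {AdS3, S32}" if "x \<in> {1, -1}" for x
    using that by (auto simp: level_def AdS3_def S32_def)
  have E_level: "E \<sigma> ` I \<inter> level x = (if c = x then E \<sigma> ` I else {})" for x
    using pip_evolute[OF _ \<sigma>] sgn_g by (auto simp: level_def)
  have F: "focal_surface (cosh, sinh) \<zeta> f1 s \<theta> \<in> level (- e)" "focal_surface (sinh, cosh) \<zeta> f1 s \<theta> \<in> level e"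
    if "s \<in> I" for s \<theta>
    by (simp_all add: level_def pip_focal_surface that \<epsilon> cosh_square_eq algebra_simps)
  have "\<exists>M\<in>{AdS3, S32}. (\<forall>s\<in>I. \<forall>\<theta>. focal_surface (cosh, sinh) \<zeta> f1 s \<theta> \<in> M) \<and>
      singular_values I (focal_surface (cosh, sinh) \<zeta> f1) = E \<sigma> ` I \<inter> M"
    using level[of "- e"] e F(1) by (intro bexI[of _ "level (- e)"]) (auto simp: sv E_level)
  moreover have "\<exists>M\<in>{AdS3, S32}. (\<forall>s\<in>I. \<forall>\<theta>. focal_surface (sinh, cosh) \<zeta> f1 s \<theta> \<in> M) \<and>
      singular_values I (focal_surface (sinh, cosh) \<zeta> f1) = E \<sigma> ` I \<inter> M"
    using level[of e] e F(2) by (intro bexI[of _ "level e"]) (auto simp: sv E_level)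
  moreover have "(\<Union>PR\<in>{(cosh, sinh), (sinh, cosh)}. singular_values I (focal_surface PR \<zeta> f1)) = E \<sigma> ` I"
    using c e by (auto simp: sv)
  ultimately show ?thesis
    using \<sigma> by (intro bexI[of _ \<sigma>]) simp_all
qed

end

text \<open>In the first case the evolute set contains both signs. In the second a single sign
  serves the whole interval and both surfaces, and \<open>M\<close> records the quadric of each
  surface, hence whether it carries the evolute.\<close>

theorem mainTheorem10:
  fixes I :: "real set"
    and \<gamma> f1 f2 \<zeta> :: "real \<Rightarrow> real^4"
    and \<alpha> l n :: "real \<Rightarrow> real"
    and e :: real
    and F1 :: "real \<Rightarrow> real \<Rightarrow> real^4"
    and F2 :: "(real \<Rightarrow> real) \<times> (real \<Rightarrow> real) \<Rightarrow> real \<Rightarrow> real \<Rightarrow> real^4"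
  assumes "is_interval I" and "interior I \<noteq> {}"
    and "spacelike_framed_immersion I \<gamma> f1 f2"
    and "has_curvature I \<gamma> f1 f2 e \<alpha> l n"
    and "\<forall>s\<in>I. (\<alpha> s)\<^sup>2 + e * (n s)\<^sup>2 \<noteq> 0"
    and "\<forall>s\<in>I. g_fun I e \<alpha> l n s \<noteq> 0"
  defines "\<zeta> \<equiv> zeta \<gamma> f2 e \<alpha> n"
    and "F1 \<equiv> focal_surface (cos, sin) \<zeta> f1"
    and "F2 \<equiv> (\<lambda>PR. focal_surface PR \<zeta> f1)"
  shows
    "(\<forall>s\<in>I. pip (\<zeta> s) (\<zeta> s) = eps_zeta e \<alpha> n s) \<and>
     ((\<forall>s\<in>I. eps_zeta e \<alpha> n s * e = 1) \<longrightarrow>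
        (\<forall>s\<in>I. timelike (\<zeta> s) \<and> timelike (f1 s)) \<and>
        (\<forall>s\<in>I. \<forall>\<theta>. F1 s \<theta> \<in> AdS3) \<and>
        (\<forall>s\<in>I. g_fun I e \<alpha> l n s < 0) \<and>
        singular_values I F1 = AdS_evolute_set I \<gamma> f1 f2 e \<alpha> l n) \<and>
     ((\<forall>s\<in>I. eps_zeta e \<alpha> n s * e = -1) \<longrightarrow>
        (\<exists>\<sigma>\<in>{1, -1}.
           (\<Union>PR\<in>{(cosh, sinh), (sinh, cosh)}. singular_values I (F2 PR))
             = evolute I \<gamma> f1 f2 e \<alpha> l n \<sigma> ` I \<and>
           (\<forall>PR\<in>{(cosh, sinh), (sinh, cosh)}. \<exists>M\<in>{AdS3, S32}.
              (\<forall>s\<in>I. \<forall>\<theta>. F2 PR s \<theta> \<in> M) \<and>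
              singular_values I (F2 PR) = evolute I \<gamma> f1 f2 e \<alpha> l n \<sigma> ` I \<inter> M)))"
proof -
  interpret regular_framed_immersion I \<gamma> f1 f2 \<alpha> l n e
    using assms(1-6) by unfold_locales auto
  show ?thesis
    unfolding \<zeta>_def F1_def F2_def
  proof (intro conjI impI)
    show "\<forall>s\<in>I. pip (zeta \<gamma> f2 e \<alpha> n s) (zeta \<gamma> f2 e \<alpha> n s) = eps_zeta e \<alpha> n s"
      using pip_zeta by blast
  next
    assume "\<forall>s\<in>I. eps_zeta e \<alpha> n s * e = 1"
    then have eps: "\<And>s. s \<in> I \<Longrightarrow> eps_zeta e \<alpha> n s * e = 1"
      by blast
    note compact = singular_values_compact[OF eps]
    show "\<forall>s\<in>I. timelike (zeta \<gamma> f2 e \<alpha> n s) \<and> timelike (f1 s)"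
      using compact(1) by blast
    show "\<forall>s\<in>I. \<forall>\<theta>. focal_surface (cos, sin) (zeta \<gamma> f2 e \<alpha> n) f1 s \<theta> \<in> AdS3"
      using compact(2) by blast
    show "\<forall>s\<in>I. g_fun I e \<alpha> l n s < 0"
      using compact(3) by blast
    show "singular_values I (focal_surface (cos, sin) (zeta \<gamma> f2 e \<alpha> n) f1) = AdS_evolute_set I \<gamma> f1 f2 e \<alpha> l n"
      by (rule compact(4))
  next
    assume "\<forall>s\<in>I. eps_zeta e \<alpha> n s * e = -1"
    then show "\<exists>\<sigma>\<in>{1, -1}.
        (\<Union>PR\<in>{(cosh, sinh), (sinh, cosh)}. singular_values I (focal_surface PR (zeta \<gamma> f2 e \<alpha> n) f1))
          = evolute I \<gamma> f1 f2 e \<alpha> l n \<sigma> ` I \<and>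
        (\<forall>PR\<in>{(cosh, sinh), (sinh, cosh)}. \<exists>M\<in>{AdS3, S32}.
          (\<forall>s\<in>I. \<forall>\<theta>. focal_surface PR (zeta \<gamma> f2 e \<alpha> n) f1 s \<theta> \<in> M) \<and>
          singular_values I (focal_surface PR (zeta \<gamma> f2 e \<alpha> n) f1) = evolute I \<gamma> f1 f2 e \<alpha> l n \<sigma> ` I \<inter> M)"
      by (intro singular_values_hyperbolic_levels) blast
  qed
qed

end
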